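(* Let $X\subseteq{}^{\omega}\mathbb{Z}$ be the set of all sequences that are eventually equal to $-1$, together with the constant sequence $0$. Then there is a bijection $F:{}^{\omega}\mathbb{Z}\setminus X\to\mathbb{R}\setminus\mathbb{Q}$ such that, for every $A\subseteq\mathbb{R}\setminus\mathbb{Q}$, the set $A$ is $\mathbb{Q}$-nowhere dense if and only if $F^{-1}(A)$ is small.
   Context: ${}^{\omega}\mathbb{Z}$ is the set of all functions $f:\omega\to\mathbb{Z}$, and each $n\in\omega$ is identified with $\{0,\dots,n-1\}$. A set $Y\subseteq\mathbb{R}$ is $\mathbb{Q}$-nowhere dense if for every $q\in\mathbb{Q}$ there is an integer $k\in\mathbb{Z}$, $k\neq 0$, such that the open interval whose endpoints are $q$ and $q+1/k$ is disjoint from $Y$. A set $Y\subseteq{}^{\omega}\mathbb{Z}$ is small if for each $n\in\omega$ and each $\sigma:n\to\mathbb{Z}$ there is some $k\in\mathbb{Z}$ such that either $\{f(n): f\in Y,\ \sigma\subseteq f\}\subseteq\{m\in\mathbb{Z}: m<k\}$ or $\{f(n): f\in Y,\ \sigma\subseteq f\}\subseteq\{m\in\mathbb{Z}: m>k\}$. *)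

theory Defs
  imports Complex_Main
begin

(* The open interval with endpoints q and q + 1/k is written with min and max,
   since q + 1/k lies below q when k is negative. *)
definition rat_nowhere_dense :: "real set \<Rightarrow> bool" where
  "rat_nowhere_dense Y \<longleftrightarrow>
     (\<forall>q\<in>\<rat>. \<exists>k::int. k \<noteq> 0 \<and>
        {min q (q + 1 / of_int k)<..<max q (q + 1 / of_int k)} \<inter> Y = {})"

(* A finite sequence with domain n = {0, ..., n - 1} is represented by a total function s
   of which only the values below n are used; "f extends s" is agreement below n. *)
definition successor_values :: "(nat \<Rightarrow> int) set \<Rightarrow> nat \<Rightarrow> (nat \<Rightarrow> int) \<Rightarrow> int set" where
  "successor_values Y n s = {f n |f. f \<in> Y \<and> (\<forall>i<n. f i = s i)}"

definition small :: "(nat \<Rightarrow> int) set \<Rightarrow> bool" where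
  "small Y \<longleftrightarrow>
     (\<forall>n s. \<exists>k::int. successor_values Y n s \<subseteq> {m. m < k} \<or> successor_values Y n s \<subseteq> {m. m > k})"

definition exceptional_seqs :: "(nat \<Rightarrow> int) set" where
  "exceptional_seqs = {f. \<exists>N. \<forall>n\<ge>N. f n = -1} \<union> {\<lambda>_. 0}"

end

theory Submission
  imports Defs "HOL-Library.Countable_Set"
begin

text \<open>
  The real line is cut repeatedly, along the tree of finite integer sequences. The whole line
  sits at the root. The interval \<open>I\<close> at a node contains a chosen rational, its pivot \<open>q\<close>, and
  \<open>I - {q}\<close> is split into half-open intervals with irrational interior cut points, one for every
  integer, which lie from left to right in the order
  \<open>0, 1, 2, ... \<rightarrow> q \<leftarrow> ..., -3, -2, -1\<close>.
  So the values near \<open>+\<infinity>\<close> are the pieces just left of \<open>q\<close> and the values near \<open>-\<infinity>\<close> are those just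
  right of it. A set avoids a one-sided neighbourhood of \<open>q\<close> exactly when the values it uses at the
  node are bounded above or below. If the pivots are precisely the rationals, smallness is
  therefore the same as being \<open>\<rat>\<close>-nowhere dense, once sequences are identified with the irrational
  points that their intervals shrink to.

  Every rational becomes a pivot because the pivot of \<open>I\<close> is the first rational in \<open>I\<close> for a fixed
  enumeration: along a branch the indices of the pivots strictly increase, so no rational survives
  in all intervals (\<open>branch_irrational\<close>). As intervals are convex and rationals are dense, two
  points on one branch coincide (\<open>branch_point_unique\<close>). It remains to see which sequences have a
  point. Since a bounded piece contains its left but not its right end, a branch has an empty
  intersection in two cases: it stays eventually in the rightmost piece and so converges to an
  excluded right end (or to \<open>+\<infinity>\<close>), or it stays always in the leftmost piece and runs off to
  \<open>-\<infinity>\<close>. These are the sequences that are eventually \<open>-1\<close> and the constant sequence \<open>0\<close>. In all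
  other cases the supremum of the left ends lies in all intervals
  (\<open>not_exceptional_has_branch\<close>).
\<close>

section \<open>Cells of the real line and their pivots\<close>

text \<open>The shape of the intervals at the nodes. A rational is required to be an interior point, whereas
  an irrational may be the left end: this is what allows half-open pieces with irrational ends,
  and unbounded ones, to be treated alike without naming their ends.\<close>

definition admissible :: "real set \<Rightarrow> bool" where
  "admissible I \<longleftrightarrow> I \<noteq> {} \<and> (\<forall>x\<in>I. \<forall>y\<in>I. {x..y} \<subseteq> I) \<and>
     (\<forall>x\<in>I. \<exists>y\<in>I. x < y) \<and> (\<forall>r\<in>I \<inter> \<rat>. \<exists>y\<in>I. y < r)"

lemma admissible_between: "\<lbrakk>admissible I; x \<in> I; y \<in> I; x \<le> z; z \<le> y\<rbrakk> \<Longrightarrow> z \<in> I"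
  unfolding admissible_def by (meson atLeastAtMost_iff subsetD)

definition pivot :: "real set \<Rightarrow> real" where
  "pivot I = arg_min (to_nat_on \<rat>) (\<lambda>r. r \<in> I \<inter> \<rat>)"

lemma admissible_contains_rational:
  assumes "admissible I" "x \<in> I"
  obtains r where "r \<in> I \<inter> \<rat>"
proof -
  obtain y where "y \<in> I" "x < y" using assms unfolding admissible_def by blast
  moreover obtain r where "r \<in> \<rat>" "x < r" "r < y" using Rats_dense_in_real \<open>x < y\<close> by blast
  ultimately show thesis using that admissible_between[OF assms(1)] assms(2) by (meson IntI less_imp_le)
qed

lemma pivot_in: "admissible I \<Longrightarrow> pivot I \<in> I \<inter> \<rat>"
  unfolding pivot_def using admissible_contains_rational arg_min_nat_lemma
  by (metis (no_types, lifting) ex_in_conv admissible_def)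

lemma pivot_first: "r \<in> I \<inter> \<rat> \<Longrightarrow> to_nat_on \<rat> (pivot I) \<le> to_nat_on \<rat> r"
  unfolding pivot_def by (rule arg_min_nat_le)

text \<open>A scale on which \<open>q\<close> lies at infinity: on both sides of \<open>q\<close> the map is increasing, it tends to
  \<open>+\<infinity>\<close> at \<open>q\<close> from the left and to \<open>-\<infinity>\<close> from the right. The pieces around a pivot, apart from
  the two outermost, are unit intervals on this scale. The factor \<open>sqrt 2\<close> makes their ends irrational.\<close>

definition blowup :: "real \<Rightarrow> real \<Rightarrow> real" where
  "blowup q x = sqrt 2 / (q - x)"

lemma blowup_inverse: "v \<noteq> 0 \<Longrightarrow> blowup q (q - sqrt 2 / v) = v"
  by (simp add: blowup_def)

lemma blowup_pos_iff: "0 < blowup q x \<longleftrightarrow> x < q"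
  by (simp add: blowup_def zero_less_divide_iff)

lemma blowup_neg_iff: "blowup q x < 0 \<longleftrightarrow> q < x"
  by (simp add: blowup_def divide_less_0_iff)

lemma blowup_mono: "\<lbrakk>x \<le> y; y < q \<or> q < x\<rbrakk> \<Longrightarrow> blowup q x \<le> blowup q y"
  unfolding blowup_def by (rule divide_left_mono) (auto simp: zero_less_mult_iff)

lemma sqrt_2_irrational: "sqrt 2 \<notin> \<rat>"
proof
  assume "sqrt 2 \<in> \<rat>"
  then obtain m n where n: "n \<noteq> 0" and eq: "\<bar>sqrt 2\<bar> = real m / real n" and "coprime m n"
    by (rule Rats_abs_nat_div_natE)
  have "sqrt 2 * real n = real m" using eq n by simp
  then have "(sqrt 2 * real n)\<^sup>2 = (real m)\<^sup>2" by simp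
  then have "2 * (real n)\<^sup>2 = (real m)\<^sup>2" by (simp add: power_mult_distrib)
  then have "real (2 * n\<^sup>2) = real (m\<^sup>2)" by simp
  then have sq: "2 * n\<^sup>2 = m\<^sup>2" by (simp only: of_nat_eq_iff)
  have "even (m\<^sup>2)" by (simp flip: sq)
  then have "even m" by simp
  then obtain k where "m = 2 * k" by blast
  with sq have "n\<^sup>2 = 2 * k\<^sup>2" by (simp add: power2_eq_square)
  then have "even (n\<^sup>2)" by simp
  then have "even n" by simp
  with \<open>even m\<close> \<open>coprime m n\<close> show False using coprime_common_divisor[of m n 2] by simp
qed

lemma blowup_irrational:
  assumes "q \<in> \<rat>" "r \<in> \<rat>" "r \<noteq> q"
  shows "blowup q r \<notin> \<rat>"
proof
  assume "blowup q r \<in> \<rat>"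
  then have "blowup q r * (q - r) \<in> \<rat>" using assms by simp
  then show False using assms sqrt_2_irrational by (simp add: blowup_def)
qed

text \<open>Pieces whose scale value is too small may lie outside the interval; the spread tells how many
  to skip on either side, so that all pieces that remain are nonempty.\<close>

definition spread :: "real set \<Rightarrow> int" where
  "spread I = (SOME K. 0 < K \<and> pivot I - sqrt 2 / of_int K \<in> I \<and> pivot I + sqrt 2 / of_int K \<in> I)"

lemma spread:
  assumes "admissible I"
  shows spread_pos: "0 < spread I"
    and spread_left: "pivot I - sqrt 2 / of_int (spread I) \<in> I"
    and spread_right: "pivot I + sqrt 2 / of_int (spread I) \<in> I"
proof -
  let ?q = "pivot I"
  obtain a b where ab: "a \<in> I" "a < ?q" "b \<in> I" "?q < b"
    using assms pivot_in[OF assms] unfolding admissible_def by blast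
  define e where "e = min (?q - a) (b - ?q)"
  have "e > 0" using ab by (simp add: e_def)
  obtain K :: nat where K: "sqrt 2 / e < K" using reals_Archimedean2 by blast
  have "0 < sqrt 2 / e" using \<open>e > 0\<close> by simp
  then have "0 < real K" using K by linarith
  then have "sqrt 2 / K < e" using K \<open>e > 0\<close> by (simp add: field_simps)
  moreover have "0 < sqrt 2 / K" using \<open>0 < real K\<close> by simp
  ultimately have "?q - sqrt 2 / K \<in> I" "?q + sqrt 2 / K \<in> I"
    using ab pivot_in[OF assms] unfolding e_def
    by (auto intro: admissible_between[OF assms ab(1,3)])
  then have "0 < int K \<and> ?q - sqrt 2 / of_int (int K) \<in> I \<and> ?q + sqrt 2 / of_int (int K) \<in> I"
    using \<open>0 < real K\<close> by simp
  from someI[of "\<lambda>K. 0 < K \<and> ?q - sqrt 2 / of_int K \<in> I \<and> ?q + sqrt 2 / of_int K \<in> I", OF this]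
  show "0 < spread I" "?q - sqrt 2 / of_int (spread I) \<in> I" "?q + sqrt 2 / of_int (spread I) \<in> I"
    unfolding spread_def by blast+
qed

text \<open>The integer part on the blown-up scale, shifted towards zero by the spread. The cut-offs at
  \<open>0\<close> and \<open>-1\<close> let the two outermost pieces absorb what is left of the interval.\<close>

definition slot :: "real set \<Rightarrow> real \<Rightarrow> int" where
  "slot I x = (let u = \<lfloor>blowup (pivot I) x\<rfloor> in
     if u \<ge> 0 then max 0 (u - spread I) else min (-1) (u + spread I))"

definition child :: "real set \<Rightarrow> int \<Rightarrow> real set" where
  "child I m = {x \<in> I. x \<noteq> pivot I \<and> slot I x = m}"

lemma slot_nonneg_iff: "x \<noteq> pivot I \<Longrightarrow> 0 \<le> slot I x \<longleftrightarrow> x < pivot I"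
  using blowup_neg_iff[of "pivot I" x] blowup_pos_iff[of "pivot I" x]
  by (auto simp: slot_def Let_def)

lemma slot_mono:
  assumes "x \<le> y" "y < pivot I \<or> pivot I < x"
  shows "slot I x \<le> slot I y"
  using floor_mono[OF blowup_mono[OF assms]] assms
    blowup_neg_iff[of "pivot I" x] blowup_pos_iff[of "pivot I" x]
    blowup_neg_iff[of "pivot I" y] blowup_pos_iff[of "pivot I" y]
  by (auto simp: slot_def Let_def)

lemma slot_eqI: "\<lfloor>blowup (pivot I) x\<rfloor> = \<lfloor>blowup (pivot I) y\<rfloor> \<Longrightarrow> slot I x = slot I y"
  by (simp add: slot_def)

lemma child_nonempty:
  assumes "admissible I"
  shows "child I m \<noteq> {}"
proof -
  let ?q = "pivot I" and ?K = "spread I"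
  \<comment> \<open>Undoing the shift in the definition of the slot gives the value on the blown-up scale.\<close>
  define v where "v = (if m \<ge> 0 then m + ?K else m - ?K)"
  define x where "x = ?q - sqrt 2 / of_int v"
  have K: "0 < ?K" by (rule spread_pos[OF assms])
  then have "v \<noteq> 0" by (auto simp: v_def)
  then have u: "\<lfloor>blowup ?q x\<rfloor> = v" by (simp add: x_def blowup_inverse)
  have slot: "slot I x = m" using K by (auto simp: slot_def u v_def)
  have "sqrt 2 / \<bar>of_int v\<bar> \<le> sqrt 2 / of_int ?K"
    using K by (intro divide_left_mono) (auto simp: v_def zero_less_mult_iff)
  then have le: "\<bar>sqrt 2 / of_int v\<bar> \<le> sqrt 2 / of_int ?K" by (simp add: abs_divide)
  have "?q - sqrt 2 / of_int ?K \<le> x" "x \<le> ?q + sqrt 2 / of_int ?K"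
    using le unfolding x_def abs_le_iff by linarith+
  then have "x \<in> I" using admissible_between[OF assms spread_left[OF assms] spread_right[OF assms]] by blast
  moreover have "x \<noteq> ?q" using \<open>v \<noteq> 0\<close> by (simp add: x_def)
  ultimately show ?thesis using slot by (auto simp: child_def)
qed

lemma slot_between:
  assumes "x \<noteq> pivot I" "y \<noteq> pivot I" "slot I x = slot I y" "x \<le> z" "z \<le> y"
  shows "z \<noteq> pivot I" "slot I z = slot I x"
proof -
  have side: "y < pivot I \<or> pivot I < x"
    using assms(1-3) slot_nonneg_iff[of x I] slot_nonneg_iff[of y I] by auto
  then show "z \<noteq> pivot I" using assms by auto
  have "slot I x \<le> slot I z" using side assms by (intro slot_mono) auto
  moreover have "slot I z \<le> slot I y" using side assms by (intro slot_mono) auto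
  ultimately show "slot I z = slot I x" using assms(3) by simp
qed

lemma child_between:
  assumes "admissible I" "x \<in> child I m" "y \<in> child I m" "x \<le> z" "z \<le> y"
  shows "z \<in> child I m"
  using slot_between[of x I y z] admissible_between[of I x y z] assms by (simp add: child_def)

text \<open>The blown-up scale takes all nonzero values, so a point can be moved a little to either side
  without changing its slot, as long as the integer part of its value is kept.\<close>

lemma slot_at_same_floor:
  assumes x: "x \<noteq> pivot I" and v: "v \<noteq> 0" "\<lfloor>v\<rfloor> = \<lfloor>blowup (pivot I) x\<rfloor>"
  obtains y where "y \<noteq> pivot I" "slot I y = slot I x"
    "blowup (pivot I) x < v \<Longrightarrow> x < y" "v < blowup (pivot I) x \<Longrightarrow> y < x"
proof
  let ?q = "pivot I"
  let ?u = "blowup ?q x" and ?y = "?q - sqrt 2 / v"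
  have u: "?u \<noteq> 0" "x = ?q - sqrt 2 / ?u" using x by (simp_all add: blowup_def)
  have "0 \<le> v \<longleftrightarrow> 0 \<le> ?u" using v(2) by (metis zero_le_floor)
  then have sign: "0 < v * ?u" using u(1) v(1) by (auto simp: zero_less_mult_iff)
  show "?y \<noteq> ?q" using v by simp
  show "slot I ?y = slot I x" using v by (intro slot_eqI) (simp add: blowup_inverse)
  show "x < ?y" if "?u < v"
  proof -
    have "sqrt 2 / v < sqrt 2 / ?u"
      using that sign by (intro divide_strict_left_mono) (auto simp: mult.commute)
    then show ?thesis using u(2) by linarith
  qed
  show "?y < x" if "v < ?u"
  proof -
    have "sqrt 2 / ?u < sqrt 2 / v"
      using that sign by (intro divide_strict_left_mono) (auto simp: mult.commute)
    then show ?thesis using u(2) by linarith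
  qed
qed

text \<open>A number is strictly below its integer part plus one, so there is always room to the right within
  the same slot.\<close>

lemma child_extends_right:
  assumes "admissible I" "x \<in> child I m"
  shows "\<exists>y\<in>child I m. x < y"
proof -
  let ?u = "blowup (pivot I) x"
  have x: "x \<in> I" "x \<noteq> pivot I" "slot I x = m" using assms by (auto simp: child_def)
  have "?u < of_int \<lfloor>?u\<rfloor> + 1" by linarith
  then obtain v where v: "?u < v" "v < of_int \<lfloor>?u\<rfloor> + 1" using dense by blast
  then have floor: "\<lfloor>v\<rfloor> = \<lfloor>?u\<rfloor>" by linarith
  moreover have "v \<noteq> 0"
  proof
    assume "v = 0"
    then have "\<lfloor>?u\<rfloor> = 0" using floor by simp
    then show False using v(1) \<open>v = 0\<close> by linarith
  qed
  ultimately obtain y where y: "y \<noteq> pivot I" "slot I y = m" "x < y"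
    using slot_at_same_floor[of x I v] x v(1) by metis
  \<comment> \<open>The nearby point may lie outside the interval; a point of the interval caps it.\<close>
  obtain y0 where y0: "y0 \<in> I" "x < y0" using assms(1) x(1) unfolding admissible_def by blast
  have "min y y0 \<in> I" using y y0 admissible_between[OF assms(1) x(1) y0(1)] by simp
  moreover have "x \<le> min y y0" "min y y0 \<le> y" using y y0 by auto
  ultimately have "min y y0 \<in> child I m"
    using slot_between[of x I y "min y y0"] x y by (auto simp: child_def)
  then show ?thesis using y y0 by (intro bexI[of _ "min y y0"]) auto
qed

text \<open>The role of \<open>sqrt 2\<close>: a rational point has an irrational value on the blown-up scale, so it is
  not the left end of its piece.\<close>

lemma child_extends_left:
  assumes "admissible I" "r \<in> child I m" "r \<in> \<rat>"
  shows "\<exists>y\<in>child I m. y < r"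
proof -
  let ?u = "blowup (pivot I) r"
  have r: "r \<in> I" "r \<noteq> pivot I" "slot I r = m" using assms by (auto simp: child_def)
  have "?u \<notin> \<rat>" using blowup_irrational pivot_in[OF assms(1)] assms(3) r(2) by blast
  then have "of_int \<lfloor>?u\<rfloor> \<noteq> ?u" by (metis Rats_of_int)
  then have "of_int \<lfloor>?u\<rfloor> < ?u" by linarith
  then obtain v where v: "of_int \<lfloor>?u\<rfloor> < v" "v < ?u" using dense by blast
  then have floor: "\<lfloor>v\<rfloor> = \<lfloor>?u\<rfloor>" by linarith
  moreover have "v \<noteq> 0"
  proof
    assume "v = 0"
    then have "\<lfloor>?u\<rfloor> = 0" using floor by simp
    then show False using v(1) \<open>v = 0\<close> by simp
  qed
  ultimately obtain y where y: "y \<noteq> pivot I" "slot I y = m" "y < r"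
    using slot_at_same_floor[of r I v] r v(2) by metis
  obtain y0 where y0: "y0 \<in> I" "y0 < r" using assms(1,3) r(1) unfolding admissible_def by blast
  have "max y y0 \<in> I" using y y0 admissible_between[OF assms(1) y0(1) r(1)] by simp
  moreover have "y \<le> max y y0" "max y y0 \<le> r" using y y0 by auto
  ultimately have "max y y0 \<in> child I m"
    using slot_between[of y I r "max y y0"] r y by (auto simp: child_def)
  then show ?thesis using y y0 by (intro bexI[of _ "max y y0"]) auto
qed

lemma admissible_child:
  assumes "admissible I"
  shows "admissible (child I m)"
  unfolding admissible_def
proof (intro conjI ballI)
  show "child I m \<noteq> {}" by (rule child_nonempty[OF assms])
  show "{x..y} \<subseteq> child I m" if "x \<in> child I m" "y \<in> child I m" for x y
    using child_between[OF assms that] by auto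
  show "\<exists>y\<in>child I m. x < y" if "x \<in> child I m" for x
    by (rule child_extends_right[OF assms that])
  show "\<exists>y\<in>child I m. y < r" if "r \<in> child I m \<inter> \<rat>" for r
    using that child_extends_left[OF assms] by blast
qed

lemma child_0_downward:
  assumes "admissible I" "x \<in> child I 0" "y \<in> I" "y \<le> x"
  shows "y \<in> child I 0"
proof -
  have x: "x \<noteq> pivot I" "slot I x = 0" using assms by (auto simp: child_def)
  then have "x < pivot I" using slot_nonneg_iff[of x I] by auto
  then show ?thesis using slot_mono[of y x I] slot_nonneg_iff[of y I] x assms
    by (auto simp: child_def)
qed

lemma child_minus_1_upward:
  assumes "admissible I" "x \<in> child I (-1)" "y \<in> I" "x \<le> y"
  shows "y \<in> child I (-1)"
proof -
  have x: "x \<noteq> pivot I" "slot I x = -1" using assms by (auto simp: child_def)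
  then have "pivot I < x" using slot_nonneg_iff[of x I] by auto
  then show ?thesis using slot_mono[of x y I] slot_nonneg_iff[of y I] x assms
    by (auto simp: child_def)
qed

text \<open>All pieces but the rightmost stay away from the right end of the interval. Hence a branch that
  leaves the rightmost piece infinitely often cannot converge to an excluded right end.\<close>

lemma child_bounded_within:
  assumes "admissible I" "m \<noteq> -1"
  obtains y where "y \<in> I" "\<And>z. z \<in> child I m \<Longrightarrow> z \<le> y"
proof (cases "m \<ge> 0")
  case True
  then have "z \<le> pivot I" if "z \<in> child I m" for z
    using that slot_nonneg_iff[of z I] by (auto simp: child_def)
  then show thesis using that pivot_in[OF assms(1)] by blast
next
  case False
  obtain y where y: "y \<in> child I (-1)" using child_nonempty[OF assms(1)] by blast
  have "z \<le> y" if "z \<in> child I m" for z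
  proof (rule ccontr)
    assume "\<not> z \<le> y"
    then have "z \<in> child I (-1)"
      using child_minus_1_upward[OF assms(1) y, of z] that by (auto simp: child_def)
    then show False using that assms(2) by (auto simp: child_def)
  qed
  then show thesis using that y by (auto simp: child_def)
qed

definition least_of :: "real set \<Rightarrow> real \<Rightarrow> bool" where
  "least_of I a \<longleftrightarrow> a \<in> I \<and> (\<forall>x\<in>I. a \<le> x)"

text \<open>Only the leftmost piece shares its left end with the whole interval; all others start at a point
  with an integer value on the blown-up scale.\<close>

lemma child_least:
  assumes "admissible I" "m \<noteq> 0 \<or> (\<exists>a. least_of I a)"
  shows "\<exists>a. least_of (child I m) a"
proof (cases "m = 0")
  case True
  then obtain a where a: "least_of I a" using assms(2) by blast
  obtain x where "x \<in> child I 0" using child_nonempty[OF assms(1)] by blast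
  with a have "a \<in> child I 0" using child_0_downward[OF assms(1), of x a]
    by (auto simp: least_of_def child_def)
  with a True show ?thesis by (auto simp: least_of_def child_def)
next
  case False
  let ?q = "pivot I" and ?K = "spread I"
  have K: "0 < ?K" by (rule spread_pos[OF assms(1)])
  \<comment> \<open>The value on the blown-up scale at which the piece starts.\<close>
  define v where "v = (if m > 0 then m + ?K else m - ?K)"
  define a where "a = ?q - sqrt 2 / of_int v"
  have "v \<noteq> 0" using K False by (auto simp: v_def)
  have least: "a \<le> x" if "x \<in> child I m" for x
  proof -
    let ?u = "blowup ?q x"
    have x: "x \<noteq> ?q" "slot I x = m" using that by (auto simp: child_def)
    then have "v \<le> \<lfloor>?u\<rfloor>" "v < 0 \<longleftrightarrow> \<lfloor>?u\<rfloor> < 0"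
      using K False by (auto simp: slot_def Let_def v_def split: if_splits)
    then have vu: "of_int v \<le> ?u" "0 < of_int v * ?u" 
      using \<open>v \<noteq> 0\<close> by (auto simp: le_floor_iff zero_less_mult_iff) 
    then have "sqrt 2 / ?u \<le> sqrt 2 / of_int v" by (intro divide_left_mono) (auto simp: mult.commute)
    moreover have "x = ?q - sqrt 2 / ?u" using x by (simp add: blowup_def)
    ultimately show ?thesis by (simp add: a_def)
  qed
  have u: "\<lfloor>blowup ?q a\<rfloor> = v" using \<open>v \<noteq> 0\<close> by (simp add: a_def blowup_inverse)
  have "slot I a = m" using K False by (auto simp: slot_def u v_def)
  moreover have "a \<noteq> ?q" using \<open>v \<noteq> 0\<close> by (simp add: a_def)
  moreover obtain x where x: "x \<in> child I m" using child_nonempty[OF assms(1)] by blast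
  moreover have "a \<in> I"
  proof -
    have "?q - sqrt 2 / of_int ?K \<le> a"
    proof (cases "m > 0")
      case True
      then have "sqrt 2 / of_int v \<le> sqrt 2 / of_int ?K"
        using K by (intro divide_left_mono) (auto simp: v_def zero_less_mult_iff)
      then show ?thesis by (simp add: a_def)
    next
      case False
      then have "of_int v < (0::real)" using K by (auto simp: v_def)
      then have "sqrt 2 / of_int v < 0" by (simp add: divide_less_0_iff)
      moreover have "0 < sqrt 2 / of_int ?K" using K by simp
      ultimately show ?thesis by (simp add: a_def)
    qed
    then show ?thesis
      using admissible_between[OF assms(1) spread_left[OF assms(1)]] least[OF x] x by (auto simp: child_def)
  qed
  ultimately show ?thesis using least by (auto simp: least_of_def child_def)
qed

section \<open>The tree of cells and its branches\<close>

fun cell :: "(nat \<Rightarrow> int) \<Rightarrow> nat \<Rightarrow> real set" where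
  "cell s 0 = UNIV"
| "cell s (Suc n) = child (cell s n) (s n)"

definition branch :: "(nat \<Rightarrow> int) \<Rightarrow> real \<Rightarrow> bool" where
  "branch f x \<longleftrightarrow> (\<forall>n. x \<in> cell f n)"

lemma admissible_UNIV: "admissible UNIV"
  unfolding admissible_def by (auto intro: gt_ex lt_ex)

lemma admissible_cell: "admissible (cell s n)"
  by (induction n) (auto intro: admissible_UNIV admissible_child)

lemma cell_antimono: "m \<le> n \<Longrightarrow> cell s n \<subseteq> cell s m"
  by (rule lift_Suc_antimono_le[of "cell s"]) (auto simp: child_def)

lemma cell_cong: "(\<And>i. i < n \<Longrightarrow> s i = t i) \<Longrightarrow> cell s n = cell t n"
  by (induction n) auto

lemma cell_determines:
  assumes "x \<in> cell s n" "x \<in> cell t n" "i < n"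
  shows "s i = t i"
  using assms
proof (induction i rule: less_induct)
  case (less i)
  then have "cell s i = cell t i" by (intro cell_cong) auto
  moreover have "x \<in> cell s (Suc i)" "x \<in> cell t (Suc i)"
    using less.prems cell_antimono[of "Suc i" n] by (auto dest: subsetD)
  ultimately show ?case by (auto simp: child_def)
qed

text \<open>The index of the pivot strictly increases along a branch, since every pivot is removed when its
  interval is split. The index of a rational that stayed in all intervals would bound it.\<close>

lemma branch_irrational:
  assumes "branch f x"
  shows "x \<notin> \<rat>"
proof
  assume "x \<in> \<rat>"
  let ?i = "\<lambda>n. to_nat_on \<rat> (pivot (cell f n))"
  have "?i n < ?i (Suc n)" for n
  proof -
    let ?p = "pivot (cell f n)" and ?p' = "pivot (cell f (Suc n))"
    have p: "?p \<in> \<rat>" and p': "?p' \<in> child (cell f n) (f n)" "?p' \<in> \<rat>"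
      using pivot_in[OF admissible_cell[of f n]] pivot_in[OF admissible_cell[of f "Suc n"]] by auto
    have "?p \<noteq> ?p'" using p' by (auto simp: child_def)
    then have "?i n \<noteq> ?i (Suc n)" using p p'(2) by (metis countable_rat from_nat_into_to_nat_on)
    moreover have "?i n \<le> ?i (Suc n)" using p' by (intro pivot_first) (auto simp: child_def)
    ultimately show ?thesis by simp
  qed
  then have "strict_mono ?i" by (simp add: strict_mono_Suc_iff)
  then have "n \<le> ?i n" for n by (rule strict_mono_imp_increasing)
  moreover have "?i n \<le> to_nat_on \<rat> x" for n
    using assms \<open>x \<in> \<rat>\<close> by (intro pivot_first) (auto simp: branch_def)
  ultimately show False by (metis Suc_n_not_le_n order_trans)
qed

text \<open>A rational between two points of a branch would be on the branch as well.\<close>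

lemma branch_point_unique:
  assumes "branch f x" "branch f y"
  shows "x = y"
proof -
  have False if less: "x < y" and xy: "branch f x" "branch f y" for x y
  proof -
    obtain r where r: "r \<in> \<rat>" "x < r" "r < y" using Rats_dense_in_real less by blast
    then have "branch f r" using xy admissible_between[OF admissible_cell, of x f _ y r] by (auto simp: branch_def)
    then show False using r branch_irrational by blast
  qed
  then show ?thesis using assms by (meson linorder_less_linear)
qed

lemma branch_seq_unique: "branch f x \<Longrightarrow> branch g x \<Longrightarrow> f = g"
  unfolding branch_def using cell_determines by (metis ext lessI)

text \<open>The intervals that contain a given point, obtained without a sequence: the slot to be chosen next
  is read off from the point.\<close>

fun trail :: "real \<Rightarrow> nat \<Rightarrow> real set" where
  "trail x 0 = UNIV"
| "trail x (Suc n) = child (trail x n) (slot (trail x n) x)"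

text \<open>A point can be followed down the tree for ever unless it is removed as a pivot.\<close>

lemma pivot_or_branch: "(\<exists>f. branch f x) \<or> (\<exists>s n. pivot (cell s n) = x)"
proof (rule disjCI)
  assume *: "\<not> (\<exists>s n. pivot (cell s n) = x)"
  define f where "f n = slot (trail x n) x" for n
  have cell: "cell f n = trail x n" for n by (induction n) (auto simp: f_def)
  have "x \<in> trail x n" for n
  proof (induction n)
    case (Suc n)
    then show ?case using * cell[of n] by (metis (mono_tags, lifting) child_def mem_Collect_eq trail.simps(2))
  qed simp
  then have "branch f x" by (simp add: branch_def cell)
  then show "\<exists>f. branch f x" by blast
qed

lemma rational_is_pivot: "q \<in> \<rat> \<Longrightarrow> \<exists>s n. pivot (cell s n) = q"
  using pivot_or_branch branch_irrational by blast

lemma irrational_has_branch: "x \<notin> \<rat> \<Longrightarrow> \<exists>f. branch f x"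
  using pivot_or_branch[of x] pivot_in[OF admissible_cell] by (metis IntD2)

text \<open>The rightmost piece is upward closed in its interval, and no interval has a last point. So a point
  that always stays in rightmost pieces from some stage on could be replaced by a larger one, and
  the branch would have two points. In the same way, on the constant sequence \<open>0\<close> a point could
  be moved to the left, starting from the whole line.\<close>

lemma branch_not_exceptional:
  assumes "branch f x"
  shows "f \<notin> exceptional_seqs"
proof
  assume "f \<in> exceptional_seqs"
  then consider N where "\<forall>n\<ge>N. f n = -1" | "f = (\<lambda>_. 0)" unfolding exceptional_seqs_def by blast
  then show False
  proof cases
    case 1
    have x: "x \<in> cell f n" for n using assms by (simp add: branch_def)
    obtain y where y: "y \<in> cell f N" "x < y" using admissible_cell[of f N] x unfolding admissible_def by blast
    have "y \<in> cell f (N + k)" for k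
    proof (induction k)
      case (Suc k)
      then show ?case using child_minus_1_upward[OF admissible_cell, of x f "N + k" y] x[of "Suc (N + k)"] y 1
        by auto
    qed (use y in simp)
    then have "branch f y"
      unfolding branch_def by (metis cell_antimono le_add2 subsetD)
    then show False using branch_point_unique assms y by blast
  next
    case 2
    have x: "x \<in> cell f n" for n using assms by (simp add: branch_def)
    have "x - 1 \<in> cell f n" for n
    proof (induction n)
      case (Suc n)
      then show ?case using child_0_downward[OF admissible_cell, of x f n "x - 1"] x[of "Suc n"] 2 by auto
    qed simp
    then have "branch f (x - 1)" by (simp add: branch_def)
    then show False using branch_point_unique[OF assms] by fastforce
  qed
qed

text \<open>The point is the supremum of the left ends. Left ends exist from the first nonzero value on, and
  the supremum stays below the right ends because values other than \<open>-1\<close> keep occurring.\<close>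

lemma not_exceptional_has_branch:
  assumes "f \<notin> exceptional_seqs"
  shows "\<exists>x. branch f x"
proof -
  obtain n0 where n0: "f n0 \<noteq> 0" using assms by (auto simp: exceptional_seqs_def)
  have inf: "\<exists>n\<ge>N. f n \<noteq> -1" for N using assms by (auto simp: exceptional_seqs_def)
  have least: "\<exists>a. least_of (cell f (Suc (n0 + k))) a" for k
  proof (induction k)
    case 0
    then show ?case using child_least[OF admissible_cell, of "f n0" f n0] n0 by simp
  next
    case (Suc k)
    then show ?case using child_least[OF admissible_cell, of "f (Suc (n0 + k))" f "Suc (n0 + k)"] by simp
  qed
  define L where "L = {a. \<exists>n. least_of (cell f n) a}"
  \<comment> \<open>Comparison of a left end with an upper bound at another level, through a point of the deeper one.\<close>
  have below: "a \<le> y" if a: "a \<in> L" and y: "\<And>z. z \<in> cell f N \<Longrightarrow> z \<le> y" for a y N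
  proof -
    obtain n where n: "least_of (cell f n) a" using a by (auto simp: L_def)
    obtain p where p: "p \<in> cell f (max n N)" using admissible_cell[of f "max n N"] by (auto simp: admissible_def)
    have "p \<in> cell f n" "p \<in> cell f N" using p cell_antimono[of n "max n N" f] cell_antimono[of N "max n N" f] by auto
    then show ?thesis using n y[of p] by (auto simp: least_of_def)
  qed
  have mem: "Sup L \<in> cell f (Suc (n0 + k))" for k
  proof -
    let ?N = "Suc (n0 + k)"
    obtain n where n: "n \<ge> ?N" "f n \<noteq> -1" using inf by blast
    obtain y where y: "y \<in> cell f n" "\<And>z. z \<in> child (cell f n) (f n) \<Longrightarrow> z \<le> y"
      using child_bounded_within[OF admissible_cell n(2), of f n] by blast
    have upper: "a \<le> y" if "a \<in> L" for a
      using below[OF that, of "Suc n" y] y(2) by simp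
    obtain a where a: "least_of (cell f ?N) a" using least by blast
    then have "a \<in> L" unfolding L_def by blast
    have "a \<le> Sup L" using \<open>a \<in> L\<close> upper by (intro cSup_upper bdd_aboveI) auto
    moreover have "Sup L \<le> y" using \<open>a \<in> L\<close> upper by (intro cSup_least) auto
    moreover have "y \<in> cell f ?N" using y(1) cell_antimono[OF n(1)] by blast
    ultimately show ?thesis
      using admissible_between[OF admissible_cell, of a f ?N y "Sup L"] a by (simp add: least_of_def)
  qed
  have "Sup L \<in> cell f n" for n
    using mem[of n] cell_antimono[of n "Suc (n0 + n)" f] by auto
  then show ?thesis by (auto simp: branch_def)
qed

section \<open>Both notions of smallness at a single pivot\<close>

definition half_bounded :: "real set \<Rightarrow> bool" where
  "half_bounded V \<longleftrightarrow> bdd_above V \<or> bdd_below V"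

text \<open>Slots and the blown-up scale differ by a bounded amount inside the interval, and outside it the
  scale is bounded. Hence boundedness of the slots and of the scale are the same on either side.\<close>

lemma slot_near_blowup: "admissible I \<Longrightarrow> \<bar>of_int (slot I x) - blowup (pivot I) x\<bar> \<le> of_int (spread I) + 1"
  using spread_pos[of I] unfolding slot_def Let_def max_def min_def
  by (auto; linarith)

lemma blowup_outside:
  assumes "admissible I" "x \<notin> I"
  shows "\<bar>blowup (pivot I) x\<bar> \<le> of_int (spread I)"
proof -
  let ?q = "pivot I" and ?K = "of_int (spread I) :: real"
  have K: "0 < ?K" using spread_pos[OF assms(1)] by simp
  have "\<not> (?q - sqrt 2 / ?K \<le> x \<and> x \<le> ?q + sqrt 2 / ?K)"
    using admissible_between[OF assms(1) spread_left[OF assms(1)] spread_right[OF assms(1)]] assms(2) by blast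
  then have far: "sqrt 2 / ?K \<le> \<bar>?q - x\<bar>" by linarith
  moreover have "0 < sqrt 2 / ?K" using K by simp
  ultimately have "0 < \<bar>?q - x\<bar>" by linarith
  then have "sqrt 2 / \<bar>?q - x\<bar> \<le> ?K" using far K by (simp add: field_simps)
  then show ?thesis by (simp add: blowup_def abs_divide)
qed

lemma bdd_above_cong_near:
  fixes g h :: "'a \<Rightarrow> real"
  assumes near: "\<And>x. x \<in> B \<Longrightarrow> \<bar>g x - h x\<bar> \<le> C" and rest: "\<And>x. x \<in> A - B \<Longrightarrow> \<bar>h x\<bar> \<le> C" and "B \<subseteq> A"
  shows "bdd_above (g ` B) \<longleftrightarrow> bdd_above (h ` A)"
proof
  assume "bdd_above (g ` B)"
  then obtain M where M: "\<And>x. x \<in> B \<Longrightarrow> g x \<le> M" by (auto simp: bdd_above_def)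
  have "h x \<le> max (M + C) C" if "x \<in> A" for x
  proof (cases "x \<in> B")
    case True
    then show ?thesis using M[OF True] near[OF True] by linarith
  next
    case False
    then show ?thesis using rest[of x] that by auto
  qed
  then show "bdd_above (h ` A)" by (intro bdd_aboveI2)
next
  assume "bdd_above (h ` A)"
  then obtain M where M: "\<And>x. x \<in> A \<Longrightarrow> h x \<le> M" by (auto simp: bdd_above_def)
  have "g x \<le> M + C" if "x \<in> B" for x using M[of x] near[OF that] that assms(3) by fastforce
  then show "bdd_above (g ` B)" by (intro bdd_aboveI2)
qed

lemma half_bounded_cong_near:
  fixes g h :: "'a \<Rightarrow> real"
  assumes near: "\<And>x. x \<in> B \<Longrightarrow> \<bar>g x - h x\<bar> \<le> C" and rest: "\<And>x. x \<in> A - B \<Longrightarrow> \<bar>h x\<bar> \<le> C" and "B \<subseteq> A"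
  shows "half_bounded (g ` B) \<longleftrightarrow> half_bounded (h ` A)"
proof -
  have "bdd_above ((\<lambda>x. - g x) ` B) \<longleftrightarrow> bdd_above ((\<lambda>x. - h x) ` A)"
  proof (rule bdd_above_cong_near[OF _ _ assms(3)])
    show "\<bar>- g x - - h x\<bar> \<le> C" if "x \<in> B" for x using near[OF that] by linarith
    show "\<bar>- h x\<bar> \<le> C" if "x \<in> A - B" for x using rest[OF that] by simp
  qed
  then show ?thesis
    using bdd_above_cong_near[OF assms] bdd_above_uminus[of "g ` B"] bdd_above_uminus[of "h ` A"]
    by (simp add: half_bounded_def image_image)
qed

text \<open>Brings the condition in the definition of smallness into the form in which slots can be compared
  with the blown-up scale, which is real.\<close>

lemma half_bounded_int_iff:
  fixes V :: "int set"
  shows "half_bounded (of_int ` V) \<longleftrightarrow> (\<exists>k. V \<subseteq> {m. m < k} \<or> V \<subseteq> {m. m > k})"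
proof
  assume "half_bounded (of_int ` V)"
  then consider M where "\<forall>m\<in>V. of_int m \<le> (M::real)" | M where "\<forall>m\<in>V. (M::real) \<le> of_int m"
    unfolding half_bounded_def by (auto simp: bdd_above_def bdd_below_def)
  then show "\<exists>k. V \<subseteq> {m. m < k} \<or> V \<subseteq> {m. m > k}"
  proof cases
    case 1
    have "m < \<lfloor>M\<rfloor> + 1" if "m \<in> V" for m
      using bspec[OF 1 that] by linarith
    then show ?thesis by blast
  next
    case 2
    have "m > \<lceil>M\<rceil> - 1" if "m \<in> V" for m
      using bspec[OF 2 that] by linarith
    then show ?thesis by blast
  qed
next
  assume "\<exists>k. V \<subseteq> {m. m < k} \<or> V \<subseteq> {m. m > k}"
  then obtain k where "V \<subseteq> {m. m < k} \<or> V \<subseteq> {m. m > k}" by blast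
  then have "(\<forall>m\<in>V. of_int m \<le> (of_int k :: real)) \<or> (\<forall>m\<in>V. (of_int k :: real) \<le> of_int m)" by fastforce
  then show "half_bounded (of_int ` V)"
    unfolding half_bounded_def bdd_above_def bdd_below_def by blast
qed

lemma right_gap_iff:
  assumes "0 < k"
  shows "{q<..<q + 1 / k} \<inter> A = {} \<longleftrightarrow> (\<forall>x\<in>A. - (sqrt 2 * k) \<le> blowup q x)"
proof -
  have "x \<in> {q<..<q + 1 / k} \<longleftrightarrow> blowup q x < - (sqrt 2 * k)" for x
  proof (cases "q < x")
    case True
    then have "x < q + 1 / k \<longleftrightarrow> k * (x - q) < 1" using assms by (simp add: field_simps)
    also have "\<dots> \<longleftrightarrow> sqrt 2 * (k * (x - q)) < sqrt 2 * 1" by (subst mult_less_cancel_left_pos) simp_all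
    also have "\<dots> \<longleftrightarrow> sqrt 2 * k < sqrt 2 / (x - q)"
      using True by (simp add: pos_less_divide_eq mult.assoc)
    also have "sqrt 2 / (x - q) = - blowup q x"
      unfolding blowup_def by (metis minus_diff_eq minus_divide_right)
    finally show ?thesis using True by auto
  next
    case False
    moreover have "0 \<le> blowup q x" using False blowup_neg_iff[of q x] by linarith
    moreover have "0 < sqrt 2 * k" using assms by simp
    ultimately show ?thesis by auto
  qed
  then show ?thesis by (auto simp: not_less[symmetric])
qed

lemma left_gap_iff:
  assumes "0 < k"
  shows "{q - 1 / k<..<q} \<inter> A = {} \<longleftrightarrow> (\<forall>x\<in>A. blowup q x \<le> sqrt 2 * k)"
proof -
  have "x \<in> {q - 1 / k<..<q} \<longleftrightarrow> sqrt 2 * k < blowup q x" for x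
  proof (cases "x < q")
    case True
    then have "q - 1 / k < x \<longleftrightarrow> k * (q - x) < 1" using assms by (simp add: field_simps)
    also have "\<dots> \<longleftrightarrow> sqrt 2 * (k * (q - x)) < sqrt 2 * 1" by (subst mult_less_cancel_left_pos) simp_all
    also have "\<dots> \<longleftrightarrow> sqrt 2 * k < blowup q x"
      using True by (simp add: blowup_def pos_less_divide_eq mult.assoc)
    finally show ?thesis using True by auto
  next
    case False
    moreover have "blowup q x \<le> 0" using False blowup_pos_iff[of q x] by linarith
    moreover have "0 < sqrt 2 * k" using assms by simp
    ultimately show ?thesis by auto
  qed
  then show ?thesis by (auto simp: not_less[symmetric])
qed

text \<open>A gap to the right of \<open>q\<close> is a lower bound on the blown-up scale and a gap to the left is an
  upper bound; the intervals of length \<open>1 / k\<close> are small enough to realise any bound.\<close>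

lemma gap_iff_half_bounded:
  "(\<exists>k::int. k \<noteq> 0 \<and> {min q (q + 1 / of_int k)<..<max q (q + 1 / of_int k)} \<inter> A = {})
     \<longleftrightarrow> half_bounded (blowup q ` A)"
proof
  assume "\<exists>k::int. k \<noteq> 0 \<and> {min q (q + 1 / of_int k)<..<max q (q + 1 / of_int k)} \<inter> A = {}"
  then obtain k :: int where "k \<noteq> 0"
    and gap: "{min q (q + 1 / of_int k)<..<max q (q + 1 / of_int k)} \<inter> A = {}" by blast
  show "half_bounded (blowup q ` A)"
  proof (cases "k > 0")
    case True
    then have "\<forall>x\<in>A. - (sqrt 2 * of_int k) \<le> blowup q x"
      using gap right_gap_iff[of "of_int k" q A] by (simp add: min_def max_def)
    then have "bdd_below (blowup q ` A)" by (intro bdd_belowI2) blast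
    then show ?thesis by (simp add: half_bounded_def)
  next
    case False
    then have "0 < real_of_int (- k)" using \<open>k \<noteq> 0\<close> by simp
    moreover have "1 / real_of_int k < 0" using False \<open>k \<noteq> 0\<close> by (simp add: divide_less_0_iff)
    ultimately have "\<forall>x\<in>A. blowup q x \<le> sqrt 2 * of_int (- k)"
      using gap left_gap_iff[of "of_int (- k)" q A] by (simp add: min_def max_def)
    then have "bdd_above (blowup q ` A)" by (intro bdd_aboveI2) blast
    then show ?thesis by (simp add: half_bounded_def)
  qed
next
  assume "half_bounded (blowup q ` A)"
  then consider M where "\<forall>x\<in>A. blowup q x \<le> M" | M where "\<forall>x\<in>A. M \<le> blowup q x"
    unfolding half_bounded_def by (auto simp: bdd_above_def bdd_below_def)
  then obtain M where "(\<forall>x\<in>A. blowup q x \<le> M) \<or> (\<forall>x\<in>A. - M \<le> blowup q x)"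
    by cases (metis, metis minus_minus)
  moreover obtain n :: nat where n: "\<bar>M\<bar> < n" using reals_Archimedean2 by blast
  then have "0 < real n" by linarith
  moreover have "M \<le> sqrt 2 * n"
  proof -
    have "1 * real n \<le> sqrt 2 * n" by (intro mult_right_mono) auto
    then show ?thesis using n by linarith
  qed
  ultimately have "{q - 1 / n<..<q} \<inter> A = {} \<or> {q<..<q + 1 / n} \<inter> A = {}"
    using left_gap_iff[of n q A] right_gap_iff[of n q A] by fastforce
  then show "\<exists>k::int. k \<noteq> 0 \<and> {min q (q + 1 / of_int k)<..<max q (q + 1 / of_int k)} \<inter> A = {}"
  proof
    assume "{q - 1 / n<..<q} \<inter> A = {}"
    then show ?thesis using \<open>0 < real n\<close> by (intro exI[of _ "- int n"]) (simp add: min_def max_def)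
  next
    assume "{q<..<q + 1 / n} \<inter> A = {}"
    then show ?thesis using \<open>0 < real n\<close> by (intro exI[of _ "int n"]) (simp add: min_def max_def)
  qed
qed

lemma gap_at_pivot_iff:
  assumes "admissible I" "A \<inter> \<rat> = {}"
  shows "(\<exists>k. {m. A \<inter> child I m \<noteq> {}} \<subseteq> {m. m < k} \<or> {m. A \<inter> child I m \<noteq> {}} \<subseteq> {m. m > k})
     \<longleftrightarrow> half_bounded (blowup (pivot I) ` A)"
proof -
  have "pivot I \<notin> A" using assms pivot_in by blast
  then have "{m. A \<inter> child I m \<noteq> {}} = slot I ` (A \<inter> I)" by (auto simp: child_def)
  moreover have "half_bounded ((\<lambda>x. of_int (slot I x)) ` (A \<inter> I)) \<longleftrightarrow> half_bounded (blowup (pivot I) ` A)"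
  proof (rule half_bounded_cong_near[where C = "of_int (spread I) + 1"])
    show "\<bar>of_int (slot I x) - blowup (pivot I) x\<bar> \<le> of_int (spread I) + 1" for x
      by (rule slot_near_blowup[OF assms(1)])
    show "\<bar>blowup (pivot I) x\<bar> \<le> of_int (spread I) + 1" if "x \<in> A - A \<inter> I" for x
      using blowup_outside[OF assms(1), of x] that by auto
  qed auto
  ultimately show ?thesis by (simp add: image_image flip: half_bounded_int_iff)
qed

section \<open>The bijection\<close>

definition branch_point :: "(nat \<Rightarrow> int) \<Rightarrow> real" where
  "branch_point f = (THE x. branch f x)"

lemma branch_point_eq: "branch f x \<Longrightarrow> branch_point f = x"
  unfolding branch_point_def using branch_point_unique by blast

lemma branch_branch_point: "f \<notin> exceptional_seqs \<Longrightarrow> branch f (branch_point f)"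
  using not_exceptional_has_branch branch_point_eq by metis

lemma bij_betw_branch_point: "bij_betw branch_point (UNIV - exceptional_seqs) (UNIV - \<rat>)"
proof (rule bij_betw_imageI)
  show "inj_on branch_point (UNIV - exceptional_seqs)"
    by (rule inj_onI) (metis DiffD2 branch_branch_point branch_seq_unique)
  show "branch_point ` (UNIV - exceptional_seqs) = UNIV - \<rat>"
  proof
    show "branch_point ` (UNIV - exceptional_seqs) \<subseteq> UNIV - \<rat>"
      using branch_branch_point branch_irrational by auto
    show "UNIV - \<rat> \<subseteq> branch_point ` (UNIV - exceptional_seqs)"
      using irrational_has_branch branch_not_exceptional branch_point_eq by (metis DiffD2 DiffI UNIV_I image_eqI subsetI)
  qed
qed

text \<open>Pieces of distinct nodes at one level are disjoint, so a point of \<open>A\<close> in a piece of the interval at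
  \<open>s\<close> belongs to a sequence that extends \<open>s\<close> and continues with the number of that piece.\<close>

lemma successor_values_branch_point:
  assumes "A \<inter> \<rat> = {}"
  shows "successor_values {f \<in> UNIV - exceptional_seqs. branch_point f \<in> A} n s
    = {m. A \<inter> child (cell s n) m \<noteq> {}}" (is "?V = ?W")
proof
  show "?V \<subseteq> ?W"
  proof
    fix m assume "m \<in> ?V"
    then obtain f where f: "m = f n" "f \<notin> exceptional_seqs" "branch_point f \<in> A" "\<forall>i<n. f i = s i"
      by (auto simp: successor_values_def)
    have "branch_point f \<in> cell f (Suc n)" using branch_branch_point[OF f(2)] by (simp only: branch_def)
    then have "branch_point f \<in> child (cell s n) m" using f cell_cong[of n f s] by simp
    then show "m \<in> ?W" using f(3) by blast
  qed
  show "?W \<subseteq> ?V"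
  proof
    fix m assume "m \<in> ?W"
    then obtain x where x: "x \<in> A" "x \<in> child (cell s n) m" by blast
    then obtain f where f: "branch f x" using irrational_has_branch assms by blast
    have "x \<in> cell s n" using x by (simp add: child_def)
    moreover have "x \<in> cell f n" "x \<in> cell f (Suc n)" using f by (simp_all only: branch_def)
    ultimately have eq: "\<forall>i<n. f i = s i" using cell_determines by blast
    then have "f n = m" using \<open>x \<in> cell f (Suc n)\<close> x(2) cell_cong[of n f s] by (simp add: child_def)
    then show "m \<in> ?V"
      using eq branch_not_exceptional[OF f] branch_point_eq[OF f] x(1) by (auto simp: successor_values_def)
  qed
qed

theorem lemma1:
  "\<exists>F :: (nat \<Rightarrow> int) \<Rightarrow> real.
     bij_betw F (UNIV - exceptional_seqs) (UNIV - \<rat>) \<and>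
     (\<forall>A. A \<subseteq> UNIV - \<rat> \<longrightarrow>
        (rat_nowhere_dense A \<longleftrightarrow> small {f \<in> UNIV - exceptional_seqs. F f \<in> A}))"
proof (intro exI[of _ branch_point] conjI allI impI bij_betw_branch_point)
  fix A :: "real set"
  assume "A \<subseteq> UNIV - \<rat>"
  then have A: "A \<inter> \<rat> = {}" by blast
  have "rat_nowhere_dense A \<longleftrightarrow> (\<forall>q\<in>\<rat>. half_bounded (blowup q ` A))"
    by (simp only: rat_nowhere_dense_def gap_iff_half_bounded)
  also have "\<dots> \<longleftrightarrow> (\<forall>n s. half_bounded (blowup (pivot (cell s n)) ` A))"
    using rational_is_pivot pivot_in[OF admissible_cell] by (metis IntD2)
  also have "\<dots> \<longleftrightarrow> small {f \<in> UNIV - exceptional_seqs. branch_point f \<in> A}"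
    by (simp only: small_def successor_values_branch_point[OF A] gap_at_pivot_iff[OF admissible_cell A])
  finally show "rat_nowhere_dense A \<longleftrightarrow> small {f \<in> UNIV - exceptional_seqs. branch_point f \<in> A}" .
qed

end
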